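(* Let $\mu_t$ be a nonnegative measure in $\mathcal{M}_+([-1,1])$ and let $f\in\mathbf{C}^3[-1,1]$. For each positive integer $M$, let $m^M\in\mathbb{R}^{4M+1}$ be the vector of moments $m^M_k=\int_{[-1,1]}\phi_k\,d\mu_t$ corresponding to the monomial kernels $\phi_k(x)=x^k$, $k=0,1,\dots,4M$, and let $\dot m^M\in\mathbb{R}^{4M+1}$ be the true moment dynamics, $$\dot m^M_k=\int_{[-1,1]}\frac{\partial\phi_k(x)}{\partial x}f(x)\,d\mu_t(x),\qquad k=0,\dots,4M.$$ Let $\dot{\overline m}^M\in\mathbb{R}^{4M+1}$ be the estimated dynamics under $L_\infty$ approximation, i.e. $$\dot{\overline m}^M_k=\sum_{\ell=0}^{4M}a^k_\ell\,m^M_\ell,\qquad k=0,\dots,4M,$$ where $\sum_{\ell=0}^{4M}a^k_\ell x^\ell$ is the best $L_\infty([-1,1])$ approximation of $f(x)\,\partial_x\phi_k(x)$ by polynomials of degree at most $4M$. Then $$\lim_{M\to\infty}\|\dot{\overline m}^M-\dot m^M\|=0.$$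
   Context: $\mathcal{M}_+([-1,1])$ is the set of (finite) nonnegative Borel measures on $[-1,1]$, and $\|\cdot\|$ is the Euclidean norm. The measure $\mu_t$ is fixed (a snapshot of the agent distribution at time $t$); the estimated dynamics are evaluated at the true moments, so that the difference is the instantaneous error of the dynamics. Best $L_\infty$ approximations by polynomials of bounded degree exist and are unique. The dynamics correspond to agents governed by $\dot x_i=f(x_i)$. *)

theory Defs
  imports "HOL-Analysis.Analysis" "HOL-Computational_Algebra.Polynomial"
begin

text \<open>
  Functions of class \<open>C\<^sup>n\<close> on a set; on a closed interval the derivatives at the endpoints
  are one-sided, and nothing is required of the function outside the set.
\<close>

primrec C_class_on :: "nat \<Rightarrow> real set \<Rightarrow> (real \<Rightarrow> real) \<Rightarrow> bool" where
  "C_class_on 0 S f \<longleftrightarrow> continuous_on S f"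
| "C_class_on (Suc n) S f \<longleftrightarrow>
     (\<exists>f'. (\<forall>x\<in>S. (f has_real_derivative f' x) (at x within S)) \<and> C_class_on n S f')"

text \<open>
  The measure lives on the Borel space \<open>[-1,1]\<close>, so an integral over the whole space of \<open>\<mu>\<close>
  is an integral over \<open>[-1,1]\<close>.
\<close>

definition nonneg_borel_measure :: "real measure \<Rightarrow> bool" where
  "nonneg_borel_measure \<mu> \<longleftrightarrow>
     sets \<mu> = sets (restrict_space borel {-1..1}) \<and> finite_measure \<mu>"

definition monomial_kernel :: "nat \<Rightarrow> real \<Rightarrow> real" where
  "monomial_kernel k x = x ^ k"

definition moment :: "real measure \<Rightarrow> nat \<Rightarrow> real" where
  "moment \<mu> k = (LINT x|\<mu>. monomial_kernel k x)"

definition moment_dynamics :: "(real \<Rightarrow> real) \<Rightarrow> real measure \<Rightarrow> nat \<Rightarrow> real" where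
  "moment_dynamics f \<mu> k = (LINT x|\<mu>. deriv (monomial_kernel k) x * f x)"

text \<open>
  For functions that are continuous on \<open>[-1,1]\<close> the essential supremum is the supremum.
  The latter is meaningful only for functions bounded on \<open>[-1,1]\<close>.
\<close>

definition Linf_norm :: "(real \<Rightarrow> real) \<Rightarrow> real" where
  "Linf_norm g = (SUP x\<in>{-1..1}. \<bar>g x\<bar>)"

definition best_Linf_approx :: "nat \<Rightarrow> (real \<Rightarrow> real) \<Rightarrow> real poly \<Rightarrow> bool" where
  "best_Linf_approx N g p \<longleftrightarrow> degree p \<le> N \<and>
     (\<forall>q. degree q \<le> N \<longrightarrow>
        Linf_norm (\<lambda>x. g x - poly p x) \<le> Linf_norm (\<lambda>x. g x - poly q x))"

text \<open>
  One entry of the estimated dynamics: the coefficients of the approximating polynomial \<open>p\<close>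
  applied to the moments of order at most \<open>N\<close>.
\<close>

definition estimated_dynamics :: "nat \<Rightarrow> real poly \<Rightarrow> real measure \<Rightarrow> real" where
  "estimated_dynamics N p \<mu> = (\<Sum>l=0..N. coeff p l * moment \<mu> l)"

end

theory Submission
  imports Defs "HOL-Real_Asymp.Real_Asymp"
begin

text \<open>
  Write \<open>E\<^sub>n(g)\<close> for the error of best approximation of \<open>g\<close> on \<open>[-1,1]\<close> by polynomials of degree
  at most \<open>n\<close>. Bernstein polynomials give \<open>E\<^sub>n(g) \<le> 2L / sqrt n\<close> for \<open>L\<close>-Lipschitz \<open>g\<close>; hence
  the error in degree \<open>n + 1\<close> for \<open>g\<close> is at most \<open>2 / sqrt (n + 1)\<close> times \<open>E\<^sub>n(g')\<close>. Three such
  steps and the Weierstrass theorem for the third derivative give \<open>E\<^sub>n(f) = o(n powr (-3/2))\<close>.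
  A monomial of degree at most \<open>4M\<close> is approximated by polynomials of degree \<open>2M\<close> up to an error
  exponentially small in \<open>M\<close>. Multiplying by an approximant of \<open>f\<close> of degree \<open>2M\<close>, each of the
  \<open>4M + 1\<close> functions \<open>k x^(k-1) f(x)\<close> is approximated in degree \<open>4M\<close> up to \<open>o(M powr (-1/2))\<close>,
  so the Euclidean norm of the error vector is \<open>o(1)\<close>.
\<close>

text \<open>Plays the role of a bound \<open>e\<close> on the best error in degree \<open>n\<close>,
  in a form with a witness that needs no infimum.\<close>

definition poly_approx :: "nat \<Rightarrow> (real \<Rightarrow> real) \<Rightarrow> real \<Rightarrow> bool" where
  "poly_approx n f e \<longleftrightarrow> (\<exists>p. degree p \<le> n \<and> (\<forall>x\<in>{-1..1}. \<bar>f x - poly p x\<bar> \<le> e))"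

subsection \<open>Bernstein polynomials on \<open>[-1,1]\<close>\<close>

lemma Bernstein_sum_poly:
  "\<exists>p. degree p \<le> n \<and> (\<forall>x. poly p x = (\<Sum>k\<le>n. c k * Bernstein n k ((1 + x) / 2)))"
proof -
  \<comment> \<open>With \<open>y = (1 + x) / 2\<close> this is
    \<open>y ^ k * (1 - y) ^ (n - k)\<close>; the substitution carries [-1,1] to [0,1].\<close>
  define b where "b k = [:1/2, 1/2:] ^ k * [:1/2, -1/2::real:] ^ (n - k)" for k
  define p where "p = (\<Sum>k\<le>n. smult (c k * real (n choose k)) (b k))"
  have "degree (b k) \<le> n" if "k \<le> n" for k
  proof -
    have "degree (b k) \<le> degree ([:1/2, 1/2::real:] ^ k) + degree ([:1/2, -1/2::real:] ^ (n - k))"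
      unfolding b_def by (rule degree_mult_le)
    also have "\<dots> \<le> 1 * k + 1 * (n - k)"
      by (intro add_mono order_trans[OF degree_power_le]) auto
    finally show ?thesis using that by simp
  qed
  then have "degree p \<le> n"
    unfolding p_def by (intro degree_sum_le) (auto intro: order_trans[OF degree_smult_le])
  moreover have "1 - (1 + x) / 2 = (1 - x) / 2" for x :: real
    by (simp add: field_simps)
  then have "poly p x = (\<Sum>k\<le>n. c k * Bernstein n k ((1 + x) / 2))" for x
    by (simp add: p_def b_def poly_sum poly_power Bernstein_def mult.assoc
        add_divide_distrib diff_divide_distrib)
  ultimately show ?thesis by blast
qed

text \<open>The variance of a binomial frequency: the square is expanded in
  \<open>k * (k - 1)\<close>, \<open>k\<close> and \<open>1\<close>, whose Bernstein sums are
  known.\<close>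

lemma sum_Bernstein_variance:
  assumes "n > 0"
  shows "(\<Sum>k\<le>n. (x - real k / real n)\<^sup>2 * Bernstein n k x) = x * (1 - x) / real n"
proof -
  let ?N = "real n"
  have "(x - real k / ?N)\<^sup>2 * Bernstein n k x =
      (1 / ?N\<^sup>2) * (real k * (real k - 1) * Bernstein n k x)
      + ((1 - 2 * ?N * x) / ?N\<^sup>2) * (real k * Bernstein n k x) + x\<^sup>2 * Bernstein n k x" for k
  proof -
    have "(x - real k / ?N)\<^sup>2 =
        (1 / ?N\<^sup>2) * (real k * (real k - 1)) + ((1 - 2 * ?N * x) / ?N\<^sup>2) * real k + x\<^sup>2"
      using assms by (simp add: field_simps power2_eq_square)
    then show ?thesis by (simp only: distrib_right mult.assoc)
  qed
  then have "(\<Sum>k\<le>n. (x - real k / ?N)\<^sup>2 * Bernstein n k x) =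
      (1 / ?N\<^sup>2) * (?N * (?N - 1) * x\<^sup>2) + ((1 - 2 * ?N * x) / ?N\<^sup>2) * (?N * x) + x\<^sup>2"
    by (simp only: sum.distrib sum_distrib_left[symmetric] sum_kk_Bernstein sum_k_Bernstein
        sum_Bernstein mult_1_right)
  also have "\<dots> = x * (1 - x) / ?N"
    using assms by (simp add: field_simps power2_eq_square)
  finally show ?thesis .
qed

lemma sum_Bernstein_abs_deviation_le:
  assumes "n > 0" "0 \<le> x" "x \<le> 1"
  shows "(\<Sum>k\<le>n. \<bar>x - real k / real n\<bar> * Bernstein n k x) \<le> 1 / sqrt (real n)"
proof -
  define s where "s = sqrt (real n)"
  have s: "s > 0" "s * s = real n" using assms by (simp_all add: s_def)
  \<comment> \<open>A weighted AM-GM inequality in place of Cauchy-Schwarz. The weight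
    \<open>s\<close> makes both resulting terms at most \<open>1 / (2 * s)\<close>.\<close>
  have amgm: "\<bar>a\<bar> \<le> s / 2 * a\<^sup>2 + 1 / (2 * s)" for a :: real
  proof -
    have "0 \<le> (s * \<bar>a\<bar> - 1)\<^sup>2 / (2 * s)" using s by simp
    also have "\<dots> = s / 2 * a\<^sup>2 + 1 / (2 * s) - \<bar>a\<bar>"
      using s by (simp add: power2_eq_square field_simps)
    finally show ?thesis by simp
  qed
  have "(\<Sum>k\<le>n. \<bar>x - real k / real n\<bar> * Bernstein n k x)
      \<le> (\<Sum>k\<le>n. (s / 2 * (x - real k / real n)\<^sup>2 + 1 / (2 * s)) * Bernstein n k x)"
    by (intro sum_mono mult_right_mono amgm Bernstein_nonneg assms)
  also have "\<dots> = s / 2 * (\<Sum>k\<le>n. (x - real k / real n)\<^sup>2 * Bernstein n k x)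
      + 1 / (2 * s) * (\<Sum>k\<le>n. Bernstein n k x)"
    by (simp add: distrib_right sum.distrib sum_distrib_left mult.assoc del: sum_Bernstein)
  also have "\<dots> = s / 2 * (x * (1 - x) / (s * s)) + 1 / (2 * s)"
    using sum_Bernstein_variance[OF assms(1), of x] s(2) by simp
  also have "\<dots> \<le> s / 2 * (1 / (s * s)) + 1 / (2 * s)"
    using s(1) assms(2,3) mult_mono[of x 1 "1 - x" 1]
    by (intro add_right_mono mult_left_mono divide_right_mono) auto
  also have "\<dots> = 1 / s" using s(1) by (simp add: field_simps)
  finally show ?thesis by (simp add: s_def)
qed

text \<open>Bernstein weights are nonnegative and sum to 1, so the error is at most \<open>L\<close>
  times the mean distance to the nodes. The factor 2 is the length of [-1,1].\<close>

lemma poly_approx_Lipschitz: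
  assumes lip: "\<And>x y. x \<in> {-1..1} \<Longrightarrow> y \<in> {-1..1} \<Longrightarrow> \<bar>f x - f y\<bar> \<le> L * \<bar>x - y\<bar>"
    and n: "n > 0"
  shows "poly_approx n f (2 * L / sqrt (real n))"
proof -
  have L: "L \<ge> 0" using lip[of 1 "-1"] by simp
  obtain p where p: "degree p \<le> n"
    "\<And>x. poly p x = (\<Sum>k\<le>n. f (2 * (real k / real n) - 1) * Bernstein n k ((1 + x) / 2))"
    using Bernstein_sum_poly[of n "\<lambda>k. f (2 * (real k / real n) - 1)"] by blast
  have "\<bar>f x - poly p x\<bar> \<le> 2 * L / sqrt (real n)" if x: "x \<in> {-1..1}" for x
  proof -
    define y where "y = (1 + x) / 2"
    have y: "0 \<le> y" "y \<le> 1" "x = 2 * y - 1" using x by (auto simp: y_def field_simps)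
    have "f x - poly p x = (\<Sum>k\<le>n. (f x - f (2 * (real k / real n) - 1)) * Bernstein n k y)"
      by (simp add: p(2) y_def[symmetric] left_diff_distrib sum_subtractf flip: sum_distrib_left)
    also have "\<bar>\<dots>\<bar> \<le> (\<Sum>k\<le>n. \<bar>(f x - f (2 * (real k / real n) - 1)) * Bernstein n k y\<bar>)"
      by (rule sum_abs)
    also have "\<dots> \<le> (\<Sum>k\<le>n. 2 * L * (\<bar>y - real k / real n\<bar> * Bernstein n k y))"
    proof (rule sum_mono)
      fix k assume "k \<in> {..n}"
      then have "0 \<le> real k / real n" "real k / real n \<le> 1"
        using n by (auto simp: divide_le_eq_1)
      then have "\<bar>f x - f (2 * (real k / real n) - 1)\<bar> \<le> L * \<bar>x - (2 * (real k / real n) - 1)\<bar>"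
        using x by (intro lip) auto
      also have "x - (2 * (real k / real n) - 1) = 2 * (y - real k / real n)"
        by (simp add: y(3))
      finally have "\<bar>f x - f (2 * (real k / real n) - 1)\<bar> \<le> 2 * L * \<bar>y - real k / real n\<bar>"
        by (simp only: abs_mult abs_numeral mult_ac)
      then show "\<bar>(f x - f (2 * (real k / real n) - 1)) * Bernstein n k y\<bar>
          \<le> 2 * L * (\<bar>y - real k / real n\<bar> * Bernstein n k y)"
        using mult_right_mono[OF _ Bernstein_nonneg[OF y(1,2)]] Bernstein_nonneg[OF y(1,2)]
        unfolding abs_mult mult.assoc[symmetric] by simp
    qed
    also have "\<dots> = 2 * L * (\<Sum>k\<le>n. \<bar>y - real k / real n\<bar> * Bernstein n k y)"
      by (simp add: sum_distrib_left)
    also have "\<dots> \<le> 2 * L * (1 / sqrt (real n))"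
      using sum_Bernstein_abs_deviation_le[OF n y(1,2)] L by (intro mult_left_mono) auto
    finally show ?thesis by simp
  qed
  then show ?thesis using p(1) unfolding poly_approx_def by blast
qed

text \<open>Base case of the rate for smooth functions: mere continuity gives no rate, but every
  \<open>e\<close> is reached eventually.\<close>

lemma eventually_poly_approx_continuous:
  assumes "continuous_on {-1..1} f" and "e > 0"
  shows "eventually (\<lambda>n. poly_approx n f e) sequentially"
proof -
  have "continuous_on {0..1} (\<lambda>y. f (2 * y - 1))"
    by (intro continuous_on_compose2[OF assms(1)] continuous_intros) auto
  from Bernstein_Weierstrass[OF this assms(2)] obtain N where N:
    "\<And>n y. N \<le> n \<Longrightarrow> y \<in> {0..1} \<Longrightarrow>
      \<bar>f (2 * y - 1) - (\<Sum>k\<le>n. f (2 * (real k / real n) - 1) * Bernstein n k y)\<bar> < e"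
    by blast
  have "poly_approx n f e" if "N \<le> n" for n
  proof -
    obtain p where p: "degree p \<le> n"
      "\<And>x. poly p x = (\<Sum>k\<le>n. f (2 * (real k / real n) - 1) * Bernstein n k ((1 + x) / 2))"
      using Bernstein_sum_poly[of n "\<lambda>k. f (2 * (real k / real n) - 1)"] by blast
    have "\<bar>f x - poly p x\<bar> \<le> e" if "x \<in> {-1..1}" for x
      using N[OF \<open>N \<le> n\<close>, of "(1 + x) / 2"] that by (auto simp: p(2) field_simps)
    then show ?thesis using p(1) unfolding poly_approx_def by blast
  qed
  then show ?thesis by (auto simp: eventually_sequentially)
qed

subsection \<open>Approximation of smooth functions\<close>

lemma poly_antiderivative:
  fixes q :: "real poly"
  obtains Q where "pderiv Q = q" "degree Q \<le> Suc (degree q)"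
proof
  define Q where "Q = (\<Sum>i\<le>degree q. monom (coeff q i / real (Suc i)) (Suc i))"
  have "pderiv Q = (\<Sum>i\<le>degree q. pderiv (monom (coeff q i / real (Suc i)) (Suc i)))"
    using higher_pderiv_sum[of 1] by (simp add: Q_def)
  also have "\<dots> = (\<Sum>i\<le>degree q. monom (coeff q i) i)"
    by (simp add: pderiv_monom del: of_nat_Suc)
  also have "\<dots> = q" by (rule poly_as_sum_of_monoms)
  finally show "pderiv Q = q" .
  show "degree Q \<le> Suc (degree q)"
    unfolding Q_def by (intro degree_sum_le) (auto intro: order_trans[OF degree_monom_le])
qed

text \<open>
  Subtracting an antiderivative of an approximant of \<open>f'\<close> leaves a function with Lipschitz
  constant \<open>e\<close>.
\<close>

lemma poly_approx_antiderivative: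
  assumes der: "\<And>x. x \<in> {-1..1} \<Longrightarrow> (f has_real_derivative f' x) (at x within {-1..1})"
    and appr: "poly_approx n f' e"
  shows "poly_approx (Suc n) f (2 * e / sqrt (real (Suc n)))"
proof -
  obtain q where q: "degree q \<le> n" "\<And>x. x \<in> {-1..1} \<Longrightarrow> \<bar>f' x - poly q x\<bar> \<le> e"
    using appr by (auto simp: poly_approx_def)
  obtain Q where Q: "pderiv Q = q" "degree Q \<le> Suc (degree q)"
    by (rule poly_antiderivative)
  have "((\<lambda>x. f x - poly Q x) has_real_derivative f' x - poly q x) (at x within {-1..1})"
    if "x \<in> {-1..1}" for x
    using DERIV_diff[OF der[OF that] has_field_derivative_at_within[OF poly_DERIV[of Q x]]] Q(1)
    by simp
  then have "\<bar>(f x - poly Q x) - (f y - poly Q y)\<bar> \<le> e * \<bar>x - y\<bar>"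
    if "x \<in> {-1..1}" "y \<in> {-1..1}" for x y
    using field_differentiable_bound[of "{-1..1}" "\<lambda>x. f x - poly Q x" "\<lambda>x. f' x - poly q x" e x y]
      q(2) that by simp
  from poly_approx_Lipschitz[of "\<lambda>x. f x - poly Q x", OF this, of "Suc n"]
  obtain p where p: "degree p \<le> Suc n"
    "\<And>x. x \<in> {-1..1} \<Longrightarrow> \<bar>f x - poly Q x - poly p x\<bar> \<le> 2 * e / sqrt (real (Suc n))"
    by (auto simp: poly_approx_def)
  have "degree (Q + p) \<le> Suc n"
    using p(1) q(1) Q(2) by (intro degree_add_le) auto
  moreover have "\<bar>f x - poly (Q + p) x\<bar> \<le> 2 * e / sqrt (real (Suc n))" if "x \<in> {-1..1}" for x
    using p(2)[OF that] by (simp add: algebra_simps)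
  ultimately show ?thesis unfolding poly_approx_def by blast
qed

lemma poly_approx_mono: "poly_approx m f d \<Longrightarrow> m \<le> n \<Longrightarrow> d \<le> e \<Longrightarrow> poly_approx n f e"
  unfolding poly_approx_def by (meson order_trans)

text \<open>Each derivative gains a factor \<open>2 / sqrt n\<close>. As \<open>e\<close> is
  arbitrary, this is a little-o statement.\<close>

lemma eventually_poly_approx_C_class:
  assumes "C_class_on r {-1..1} f" and "e > 0"
  shows "eventually (\<lambda>n. poly_approx n f (e / sqrt (real n) ^ r)) sequentially"
  using assms
proof (induction r arbitrary: f e)
  case 0
  then show ?case using eventually_poly_approx_continuous by simp
next
  case (Suc r)
  obtain f' where f': "\<And>x. x \<in> {-1..1} \<Longrightarrow> (f has_real_derivative f' x) (at x within {-1..1})"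
    "C_class_on r {-1..1} f'"
    using Suc.prems(1) unfolding C_class_on.simps by blast
  \<comment> \<open>The factor 2 pays for the antiderivative step, \<open>2 ^ r\<close> for
    replacing \<open>sqrt n\<close> by \<open>sqrt (n + 1)\<close>, since
    \<open>n + 1 \<le> 4 * n\<close>.\<close>
  define d where "d = e / (2 * 2 ^ r)"
  have d: "d > 0" using Suc.prems(2) by (simp add: d_def)
  have "eventually (\<lambda>n. poly_approx (Suc n) f (e / sqrt (real (Suc n)) ^ Suc r)) sequentially"
    using Suc.IH[OF f'(2) d] eventually_gt_at_top[of 0]
  proof eventually_elim
    case (elim n)
    have "sqrt (real (Suc n)) \<le> sqrt (4 * real n)"
      using elim by (intro real_sqrt_le_mono) auto
    then have "sqrt (real (Suc n)) ^ r \<le> (2 * sqrt (real n)) ^ r"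
      by (intro power_mono) (auto simp: real_sqrt_mult)
    then have "2 * d / sqrt (real n) ^ r \<le> e / sqrt (real (Suc n)) ^ r"
      using elim Suc.prems(2) by (simp add: d_def field_simps power_mult_distrib)
    then have "2 * (d / sqrt (real n) ^ r) / sqrt (real (Suc n))
        \<le> e / sqrt (real (Suc n)) ^ r / sqrt (real (Suc n))"
      by (intro divide_right_mono) auto
    then show ?case
      by (intro poly_approx_mono[OF poly_approx_antiderivative[OF f'(1) elim(1)]]) 
         (auto simp: mult.commute)
  qed
  then show ?case by (subst (asm) eventually_sequentially_Suc)
qed

subsection \<open>Chebyshev polynomials and economization of monomials\<close>

text \<open>Chebyshev polynomials of the first kind, by their three-term recurrence.\<close>

fun cheb :: "nat \<Rightarrow> real poly" where
  "cheb 0 = 1"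
| "cheb (Suc 0) = [:0, 1:]"
| "cheb (Suc (Suc n)) = [:0, 2:] * cheb (Suc n) - cheb n"

lemma degree_cheb: "degree (cheb n) \<le> n"
proof (induction n rule: cheb.induct)
  case (3 n)
  have "degree ([:0, 2:] * cheb (Suc n)) \<le> Suc (Suc n)"
    using degree_mult_le[of "[:0, 2:]" "cheb (Suc n)"] 3(1) by simp
  then show ?case using 3(2) by (auto intro!: degree_diff_le)
qed auto

lemma poly_cheb_cos: "poly (cheb n) (cos t) = cos (real n * t)"
proof (induction n rule: cheb.induct)
  case (3 n)
  have "cos (real (Suc (Suc n)) * t) + cos (real n * t) = 2 * cos t * cos (real (Suc n) * t)"
    using cos_add[of "real (Suc n) * t" t] cos_diff[of "real (Suc n) * t" t]
    by (simp add: algebra_simps)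
  then show ?case using 3 by simp
qed auto

lemma abs_poly_cheb_le:
  assumes "x \<in> {-1..1}" shows "\<bar>poly (cheb n) x\<bar> \<le> 1"
proof -
  have "x = cos (arccos x)" using assms by simp
  then have "poly (cheb n) x = cos (real n * arccos x)" by (metis poly_cheb_cos)
  then show ?thesis by simp
qed

text \<open>The case \<open>z = 2\<close> of \<open>T_n((z + 1/z) / 2) = (z^n + z^(-n)) / 2\<close>.
  This growth outside [-1,1] is the source of the exponential decay below.\<close>

lemma poly_cheb_five_quarters: "poly (cheb n) (5/4) = (2 ^ n + (1/2) ^ n) / 2"
  by (induction n rule: cheb.induct) (simp_all add: field_simps)

lemma X_times_cheb: "[:0, 1:] * cheb (Suc n) = smult (1/2) (cheb (Suc (Suc n)) + cheb n)"
  by (rule poly_eqI) (simp add: coeff_pCons split: nat.split)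

text \<open>Multiplication by \<open>x\<close> sends each Chebyshev polynomial to a nonnegative
  combination of its neighbours, so nonnegativity survives the induction.\<close>

lemma monom_cheb_expansion:
  "\<exists>c. (\<forall>m. c m \<ge> 0) \<and> monom 1 j = (\<Sum>m\<le>j. smult (c m) (cheb m))"
proof (induction j)
  case 0
  show ?case by (intro exI[of _ "\<lambda>_. 1"]) (simp add: one_pCons monom_0)
next
  case (Suc j)
  then obtain c where c: "\<And>m. c m \<ge> 0" "monom 1 j = (\<Sum>m\<le>j. smult (c m) (cheb m))"
    by blast
  \<comment> \<open>Each coefficient goes half up and half down, except that
    \<open>x * T_0 = T_1\<close> passes \<open>c 0\<close> on whole. Below, \<open>a\<close> is the
    upward and \<open>b\<close> the downward part.\<close>
  define d where "d m = (if m = 0 then 0 else c (m - 1) / (if m = 1 then 1 else 2))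
    + (if m + 1 \<le> j then c (m + 1) / 2 else 0)" for m
  have "monom (1::real) (Suc j) = [:0, 1:] * monom 1 j"
    by (simp add: monom_Suc)
  also have "\<dots> = (\<Sum>m\<le>j. smult (c m) ([:0, 1:] * cheb m))"
    by (simp add: c(2) sum_distrib_left del: mult_pCons_left)
  also have "\<dots> = (\<Sum>m\<le>Suc j. smult (d m) (cheb m))"
  proof -
    define a where "a m = (if m = 0 then 0 else c (m - 1) / (if m = 1 then 1 else 2))" for m
    define b where "b m = (if m + 1 \<le> j then c (m + 1) / 2 else 0)" for m
    have "(\<Sum>m\<le>Suc j. smult (a m) (cheb m)) = (\<Sum>m\<le>j. smult (a (Suc m)) (cheb (Suc m)))"
      by (subst sum.atMost_Suc_shift) (simp add: a_def)
    moreover have "(\<Sum>m\<le>Suc j. smult (b m) (cheb m)) = (\<Sum>m<j. smult (c (Suc m) / 2) (cheb m))"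
      by (intro sum.mono_neutral_cong_right) (auto simp: b_def)
    moreover have "(\<Sum>m\<le>j. smult (c m) ([:0, 1:] * cheb m)) =
      (\<Sum>m\<le>j. smult (a (Suc m)) (cheb (Suc m))) + (\<Sum>m<j. smult (c (Suc m) / 2) (cheb m))"
      unfolding sum.atMost_shift
      by (simp add: a_def X_times_cheb smult_add_right sum.distrib del: mult_pCons_left cheb.simps(3))
    ultimately show ?thesis
      by (simp add: d_def a_def[symmetric] b_def[symmetric] smult_add_left sum.distrib
          del: sum.atMost_Suc One_nat_def)
  qed
  finally have "monom 1 (Suc j) = (\<Sum>m\<le>Suc j. smult (d m) (cheb m))" .
  moreover have "d m \<ge> 0" for m
    using c(1) by (auto simp: d_def)
  ultimately show ?case by blast
qed

text \<open>
  The coefficients of \<open>x ^ j\<close> in the Chebyshev basis are nonnegative, so those of index above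
  \<open>n\<close> are controlled by the value at a single point outside \<open>[-1,1]\<close>. The point \<open>5/4\<close> is
  \<open>(z + 1/z) / 2\<close> with \<open>z = 2\<close>.
\<close>

lemma poly_approx_power: "poly_approx n (\<lambda>x. x ^ j) (2 * (5/4) ^ j / 2 ^ n)"
proof -
  obtain c where c: "\<And>m. c m \<ge> 0" "monom 1 j = (\<Sum>m\<le>j. smult (c m) (cheb m))"
    using monom_cheb_expansion by blast
  have pw: "x ^ j = (\<Sum>m\<le>j. c m * poly (cheb m) x)" for x
    using arg_cong[OF c(2), of "\<lambda>p. poly p x"] by (simp add: poly_monom poly_sum)
  define A where "A = {m. m \<le> j \<and> m \<le> n}"
  define B where "B = {m. m \<le> j \<and> n < m}"
  have AB: "finite A" "finite B" "{..j} = A \<union> B" "A \<inter> B = {}"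
    by (auto simp: A_def B_def)
  define p where "p = (\<Sum>m\<in>A. smult (c m) (cheb m))"
  have "degree p \<le> n" unfolding p_def
    using AB(1) by (rule degree_sum_le)
      (auto simp: A_def intro: order_trans[OF degree_smult_le] order_trans[OF degree_cheb])
  moreover have "\<bar>x ^ j - poly p x\<bar> \<le> 2 * (5/4) ^ j / 2 ^ n" if x: "x \<in> {-1..1}" for x
  proof -
    have "x ^ j - poly p x = (\<Sum>m\<in>B. c m * poly (cheb m) x)"
      by (simp add: pw AB sum.union_disjoint p_def poly_sum)
    also have "\<bar>\<dots>\<bar> \<le> (\<Sum>m\<in>B. c m)"
      using c(1) abs_poly_cheb_le[OF x]
      by (intro order_trans[OF sum_abs] sum_mono) (simp add: abs_mult mult_left_le)
    \<comment> \<open>For \<open>m > n\<close> the inserted factor is at least 1, because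
      \<open>2 * T_m(5/4) \<ge> 2 ^ m\<close>. The sum is then completed to all
      \<open>m \<le> j\<close>, where the expansion evaluates it at \<open>5/4\<close>.\<close>
    also have "\<dots> \<le> (\<Sum>m\<in>B. c m * (2 * poly (cheb m) (5/4) / 2 ^ n))"
    proof (rule sum_mono)
      fix m assume "m \<in> B"
      then have "(2::real) ^ n \<le> 2 ^ m" by (auto simp: B_def)
      then have "2 ^ n \<le> 2 * poly (cheb m) (5/4)"
        by (simp add: poly_cheb_five_quarters add_increasing2)
      then show "c m \<le> c m * (2 * poly (cheb m) (5/4) / 2 ^ n)"
        using mult_left_mono[of 1 "2 * poly (cheb m) (5/4) / 2 ^ n" "c m"] c(1) by simp
    qed
    also have "\<dots> \<le> (\<Sum>m\<le>j. c m * (2 * poly (cheb m) (5/4) / 2 ^ n))"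
      using c(1) by (intro sum_mono2) (auto simp: B_def poly_cheb_five_quarters)
    also have "\<dots> = 2 * (\<Sum>m\<le>j. c m * poly (cheb m) (5/4)) / 2 ^ n"
      by (simp add: sum_distrib_left sum_divide_distrib mult_ac)
    also have "\<dots> = 2 * (5/4) ^ j / 2 ^ n"
      by (simp only: pw[symmetric])
    finally show ?thesis .
  qed
  ultimately show ?thesis unfolding poly_approx_def by blast
qed

subsection \<open>The error of the estimated dynamics\<close>

text \<open>From \<open>f g - p q = (f - p) g + p (g - q)\<close>, where \<open>p\<close> is bounded
  by \<open>F + d\<close> on [-1,1].\<close>

lemma poly_approx_mult:
  assumes "poly_approx m f d" and "poly_approx n g e"
    and "\<And>x. x \<in> {-1..1} \<Longrightarrow> \<bar>f x\<bar> \<le> F" and "\<And>x. x \<in> {-1..1} \<Longrightarrow> \<bar>g x\<bar> \<le> G"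
  shows "poly_approx (m + n) (\<lambda>x. f x * g x) (d * G + (F + d) * e)"
proof -
  obtain p q where p: "degree p \<le> m" "\<And>x. x \<in> {-1..1} \<Longrightarrow> \<bar>f x - poly p x\<bar> \<le> d"
    and q: "degree q \<le> n" "\<And>x. x \<in> {-1..1} \<Longrightarrow> \<bar>g x - poly q x\<bar> \<le> e"
    using assms(1,2) by (auto simp: poly_approx_def)
  have "degree (p * q) \<le> m + n"
    using degree_mult_le[of p q] p(1) q(1) by linarith
  moreover have "\<bar>f x * g x - poly (p * q) x\<bar> \<le> d * G + (F + d) * e" if x: "x \<in> {-1..1}" for x
  proof -
    have "f x * g x - poly (p * q) x = (f x - poly p x) * g x + poly p x * (g x - poly q x)"
      by (simp add: algebra_simps)
    also have "\<bar>\<dots>\<bar> \<le> \<bar>f x - poly p x\<bar> * \<bar>g x\<bar> + \<bar>poly p x\<bar> * \<bar>g x - poly q x\<bar>"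
      by (metis abs_mult abs_triangle_ineq)
    also have "\<dots> \<le> d * G + (F + d) * e"
      using p(2)[OF x] q(2)[OF x] assms(3,4)[OF x]
      by (intro add_mono mult_mono) auto
    finally show ?thesis .
  qed
  ultimately show ?thesis unfolding poly_approx_def by blast
qed

text \<open>Minimality transfers the bound of any competitor to \<open>p\<close>. Continuity makes
  the supremum for \<open>p\<close> one of a bounded set, so that it dominates pointwise
  values.\<close>

lemma best_Linf_approx_error:
  assumes best: "best_Linf_approx N g p" and cont: "continuous_on {-1..1} g"
    and appr: "poly_approx N g e" and x: "x \<in> {-1..1}"
  shows "\<bar>g x - poly p x\<bar> \<le> e"
proof -
  obtain q where q: "degree q \<le> N" "\<And>x. x \<in> {-1..1} \<Longrightarrow> \<bar>g x - poly q x\<bar> \<le> e"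
    using appr by (auto simp: poly_approx_def)
  have "continuous_on {-1..1} (\<lambda>x. \<bar>g x - poly p x\<bar>)"
    by (intro continuous_intros cont)
  then have "bdd_above ((\<lambda>x. \<bar>g x - poly p x\<bar>) ` {-1..1})"
    by (intro bounded_imp_bdd_above compact_imp_bounded compact_continuous_image) auto
  then have "\<bar>g x - poly p x\<bar> \<le> Linf_norm (\<lambda>x. g x - poly p x)"
    unfolding Linf_norm_def using x by (rule cSUP_upper2) auto
  also have "\<dots> \<le> Linf_norm (\<lambda>x. g x - poly q x)"
    using best q(1) by (simp add: best_Linf_approx_def)
  also have "\<dots> \<le> e"
    unfolding Linf_norm_def using q(2) by (intro cSUP_least) auto
  finally show ?thesis .
qed

section \<open>Integration against a finite measure on [-1,1]\<close>

lemma space_nonneg_borel_measure: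
  assumes "nonneg_borel_measure \<mu>"
  shows "space \<mu> = {-1..1}"
  using assms sets_eq_imp_space_eq[of \<mu> "restrict_space borel {-1..1}"]
  by (simp add: nonneg_borel_measure_def space_restrict_space)

lemma integrable_continuous_nonneg_borel_measure:
  fixes g :: "real \<Rightarrow> real"
  assumes "nonneg_borel_measure \<mu>" and cont: "continuous_on {-1..1} g"
  shows "integrable \<mu> g"
proof -
  have sets: "sets \<mu> = sets (restrict_space borel {-1..1})"
    using assms(1) by (simp add: nonneg_borel_measure_def)
  interpret finite_measure \<mu> using assms(1) by (simp add: nonneg_borel_measure_def)
  have meas: "g \<in> borel_measurable \<mu>"
    using borel_measurable_continuous_on_restrict[OF cont] measurable_cong_sets[OF sets refl]
    by blast
  obtain B where "\<And>x. x \<in> {-1..1} \<Longrightarrow> norm (g x) \<le> B"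
    using compact_imp_bounded[OF compact_continuous_image[OF cont]] by (force simp: bounded_iff)
  then have "AE x in \<mu>. norm (g x) \<le> B"
    by (auto simp: space_nonneg_borel_measure[OF assms(1)])
  then show ?thesis using meas by (rule integrable_const_bound)
qed

text \<open>By linearity, this turns the error of an entry into the integral of a uniform
  approximation error.\<close>

lemma estimated_dynamics_eq:
  assumes "nonneg_borel_measure \<mu>" and "degree p \<le> N"
  shows "estimated_dynamics N p \<mu> = (LINT x|\<mu>. poly p x)"
proof -
  have "integrable \<mu> (\<lambda>x. x ^ l)" for l
    by (intro integrable_continuous_nonneg_borel_measure assms(1) continuous_intros)
  then have "(LINT x|\<mu>. (\<Sum>l\<le>N. coeff p l * x ^ l)) = (\<Sum>l\<le>N. coeff p l * (LINT x|\<mu>. x ^ l))"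
    by simp
  moreover have "poly p x = (\<Sum>l\<le>N. coeff p l * x ^ l)" for x
    unfolding poly_altdef using assms(2)
    by (intro sum.mono_neutral_left) (auto simp: coeff_eq_0)
  ultimately show ?thesis
    by (simp add: estimated_dynamics_def moment_def monomial_kernel_def atLeast0AtMost)
qed

lemma abs_integral_diff_le:
  assumes "nonneg_borel_measure \<mu>" and "continuous_on {-1..1} g" and "continuous_on {-1..1} h"
    and "\<And>x. x \<in> {-1..1} \<Longrightarrow> \<bar>g x - h x\<bar> \<le> e"
  shows "\<bar>(LINT x|\<mu>. g x) - (LINT x|\<mu>. h x)\<bar> \<le> measure \<mu> (space \<mu>) * e"
proof -
  interpret finite_measure \<mu> using assms(1) by (simp add: nonneg_borel_measure_def)
  note int = integrable_continuous_nonneg_borel_measure[OF assms(1)]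
  have "(LINT x|\<mu>. g x) - (LINT x|\<mu>. h x) = (LINT x|\<mu>. g x - h x)"
    by (simp add: int assms)
  also have "\<bar>\<dots>\<bar> \<le> (LINT x|\<mu>. \<bar>g x - h x\<bar>)"
    by (rule integral_abs_bound)
  also have "\<dots> \<le> (LINT x|\<mu>. e)"
    using assms(4) by (intro integral_mono int continuous_intros assms) (auto simp: space_nonneg_borel_measure[OF assms(1)])
  finally show ?thesis by simp
qed

section \<open>From the error of one entry to the Euclidean norm\<close>

lemma deriv_monomial_kernel: "deriv (monomial_kernel k) x = real k * x ^ (k - 1)"
proof -
  have "monomial_kernel k = (\<lambda>x. x ^ k)" by (auto simp: monomial_kernel_def)
  then show ?thesis by (auto intro!: DERIV_imp_deriv derivative_eq_intros)
qed

lemma L2_set_le_sqrt_card: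
  assumes "\<And>k. k \<in> A \<Longrightarrow> \<bar>f k\<bar> \<le> c" and "c \<ge> 0"
  shows "L2_set f A \<le> sqrt (real (card A)) * c"
proof -
  have "(\<Sum>k\<in>A. (f k)\<^sup>2) \<le> real (card A) * c\<^sup>2"
    using assms by (intro sum_bounded_above) (metis abs_ge_zero power2_abs power_mono)
  then have "L2_set f A \<le> sqrt (real (card A) * c\<^sup>2)"
    unfolding L2_set_def by (rule real_sqrt_le_mono)
  then show ?thesis using assms(2) by (simp add: real_sqrt_mult)
qed

lemma C_class_on_imp_continuous_on: "C_class_on n S f \<Longrightarrow> continuous_on S f"
  by (cases n) (auto intro: DERIV_continuous_on)

text \<open>The degree \<open>4 * M\<close> is shared equally between \<open>f\<close> and
  \<open>x ^ (k - 1)\<close>; the factor \<open>k\<close> costs at most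
  \<open>4 * M\<close>.\<close>

lemma dynamics_error_le:
  fixes \<mu> :: "real measure"
  assumes \<mu>: "nonneg_borel_measure \<mu>" and cont: "continuous_on {-1..1} f"
    and F: "\<And>x. x \<in> {-1..1} \<Longrightarrow> \<bar>f x\<bar> \<le> F"
    and appr: "poly_approx (2 * M) f d"
    and k: "k \<le> 4 * M"
    and best: "best_Linf_approx (4 * M) (\<lambda>x. f x * deriv (monomial_kernel k) x) p"
  shows "\<bar>estimated_dynamics (4 * M) p \<mu> - moment_dynamics f \<mu> k\<bar>
    \<le> measure \<mu> (space \<mu>) * (4 * real M * (d + (F + d) * (2 * (25/32) ^ (2 * M))))"
proof -
  have d: "d \<ge> 0" using appr unfolding poly_approx_def by force
  have F0: "F \<ge> 0" using F[of 0] by simp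
  \<comment> \<open>For \<open>k = 0\<close> the truncated exponent is 0, harmless since the factor
    \<open>k\<close> vanishes. The base \<open>25/32\<close> is
    \<open>(5/4)\<^sup>2 / 2\<close>.\<close>
  have "(5/4::real) ^ (k - 1) \<le> (5/4) ^ (4 * M)"
    using k by (intro power_increasing) auto
  then have "2 * (5/4::real) ^ (k - 1) / 2 ^ (2 * M) \<le> 2 * (5/4) ^ (2 * (2 * M)) / 2 ^ (2 * M)"
    by (simp add: divide_right_mono)
  also have "\<dots> = 2 * (25/32) ^ (2 * M)"
    by (subst power_mult) (simp add: power_divide power2_eq_square flip: power_mult_distrib)
  finally have pw: "poly_approx (2 * M) (\<lambda>x. x ^ (k - 1)) (2 * (25/32) ^ (2 * M))"
    using poly_approx_mono[OF poly_approx_power] by blast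
  define e where "e = d + (F + d) * (2 * (25/32) ^ (2 * M))"
  have e: "e \<ge> 0" using d F0 by (simp add: e_def)
  have "\<bar>x ^ (k - 1)\<bar> \<le> 1" if "x \<in> {-1..1}" for x :: real
    using that by (simp add: power_abs power_le_one abs_le_iff)
  from poly_approx_mult[OF appr pw F this]
  have "poly_approx (4 * M) (\<lambda>x. f x * x ^ (k - 1)) e"
    by (simp add: e_def)
  then obtain q where q: "degree q \<le> 4 * M"
    "\<And>x. x \<in> {-1..1} \<Longrightarrow> \<bar>f x * x ^ (k - 1) - poly q x\<bar> \<le> e"
    by (auto simp: poly_approx_def)
  have "poly_approx (4 * M) (\<lambda>x. f x * deriv (monomial_kernel k) x) (4 * real M * e)"
    unfolding poly_approx_def
  proof (intro exI[of _ "smult (real k) q"] conjI ballI)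
    show "degree (smult (real k) q) \<le> 4 * M"
      using q(1) degree_smult_le order_trans by blast
  next
    fix x :: real assume x: "x \<in> {-1..1}"
    have "\<bar>f x * deriv (monomial_kernel k) x - poly (smult (real k) q) x\<bar>
        = real k * \<bar>f x * x ^ (k - 1) - poly q x\<bar>"
      unfolding deriv_monomial_kernel
      by (simp add: abs_mult[symmetric] right_diff_distrib mult_ac del: abs_of_nat)
         (metis abs_mult abs_of_nat right_diff_distrib)
    also have "\<dots> \<le> 4 * real M * e"
      using q(2)[OF x] e k by (intro mult_mono) auto
    finally show "\<bar>f x * deriv (monomial_kernel k) x - poly (smult (real k) q) x\<bar>
        \<le> 4 * real M * e" .
  qed
  note appr' = this
  have cont': "continuous_on {-1..1} (\<lambda>x. f x * deriv (monomial_kernel k) x)"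
    unfolding deriv_monomial_kernel by (intro continuous_intros cont)
  have "moment_dynamics f \<mu> k = (LINT x|\<mu>. f x * deriv (monomial_kernel k) x)"
    by (simp add: moment_dynamics_def mult.commute)
  moreover have "estimated_dynamics (4 * M) p \<mu> = (LINT x|\<mu>. poly p x)"
    using best by (intro estimated_dynamics_eq \<mu>) (simp add: best_Linf_approx_def)
  moreover have "\<bar>(LINT x|\<mu>. f x * deriv (monomial_kernel k) x) - (LINT x|\<mu>. poly p x)\<bar>
      \<le> measure \<mu> (space \<mu>) * (4 * real M * e)"
    using best_Linf_approx_error[OF best cont' appr']
    by (intro abs_integral_diff_le \<mu> cont') (auto intro!: continuous_intros)
  ultimately show ?thesis
    by (simp add: e_def abs_minus_commute)
qed

theorem theorem9:
  fixes \<mu> :: "real measure" and f :: "real \<Rightarrow> real"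
    and P :: "nat \<Rightarrow> nat \<Rightarrow> real poly"
  assumes "nonneg_borel_measure \<mu>"
    and "C_class_on 3 {-1..1} f"
    and "\<And>M k. M \<ge> 1 \<Longrightarrow> k \<le> 4 * M \<Longrightarrow>
           best_Linf_approx (4 * M) (\<lambda>x. f x * deriv (monomial_kernel k) x) (P M k)"
  shows "(\<lambda>M. L2_set (\<lambda>k. estimated_dynamics (4 * M) (P M k) \<mu> - moment_dynamics f \<mu> k)
                      {0..4 * M}) \<longlonglongrightarrow> 0"
proof -
  let ?E = "\<lambda>M. L2_set (\<lambda>k. estimated_dynamics (4 * M) (P M k) \<mu> - moment_dynamics f \<mu> k)
                      {0..4 * M}"
  define m where "m = measure \<mu> (space \<mu>)"
  have m: "m \<ge> 0" by (simp add: m_def)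
  have cont: "continuous_on {-1..1} f"
    using assms(2) by (rule C_class_on_imp_continuous_on)
  obtain F where F: "\<And>x. x \<in> {-1..1} \<Longrightarrow> \<bar>f x\<bar> \<le> F"
    using compact_imp_bounded[OF compact_continuous_image[OF cont]] by (force simp: bounded_iff)
  have F0: "F \<ge> 0" using F[of 0] by simp
  \<comment> \<open>The contribution of the monomial approximation without the factor
    \<open>m * (F + d)\<close>; exponential decay beats the power of \<open>M\<close>.\<close>
  define w where "w M = sqrt (real (4 * M + 1)) * (4 * real M * (2 * (25/32) ^ (2 * M)))"
    for M :: nat
  have w: "w \<longlonglongrightarrow> 0"
    unfolding w_def by real_asymp
  have "eventually (\<lambda>M. ?E M < r) sequentially" if r: "r > 0" for r
  proof -
    \<comment> \<open>The second entry yields \<open>4 * m * \<eta> \<le> r / 2\<close>, with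
      \<open>m + 1\<close> keeping the denominator positive when \<open>m = 0\<close>. The cap 1
      ensures \<open>d \<le> 1\<close>.\<close>
    define \<eta> where "\<eta> = min 1 (r / (8 * (m + 1)))"
    have \<eta>: "0 < \<eta>" "\<eta> \<le> 1" using r m by (auto simp: \<eta>_def)
    have "4 * (m * \<eta>) \<le> 4 * ((m + 1) * (r / (8 * (m + 1))))"
      using m r by (intro mult_left_mono mult_mono) (auto simp: \<eta>_def)
    also have "\<dots> = r / 2"
    proof -
      have "m + 1 \<noteq> 0" using m by simp
      then show ?thesis by (simp add: divide_simps)
    qed
    finally have small1: "4 * (m * \<eta>) \<le> r / 2" .
    have "(\<lambda>M. m * (F + 1) * w M) \<longlonglongrightarrow> 0"
      using tendsto_mult_left[OF w, of "m * (F + 1)"] by simp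
    then have small2: "eventually (\<lambda>M. m * (F + 1) * w M < r / 2) sequentially"
      using r by (intro order_tendstoD) auto
    have "filterlim (\<lambda>M::nat. 2 * M) at_top sequentially"
      by (intro filterlim_subseq) (auto simp: strict_mono_def)
    from eventually_compose_filterlim[OF eventually_poly_approx_C_class[OF assms(2) \<eta>(1)] this]
    have "eventually (\<lambda>M. poly_approx (2 * M) f (\<eta> / sqrt (real (2 * M)) ^ 3)) sequentially" .
    then show ?thesis
      using small2 eventually_ge_at_top[of 1]
    proof eventually_elim
      case (elim M)
      define d where "d = \<eta> / sqrt (real (2 * M)) ^ 3"
      define e where "e = m * (4 * real M * (d + (F + d) * (2 * (25/32) ^ (2 * M))))"
      have "1 \<le> sqrt (real (2 * M)) ^ 3"
        using elim(3) by (intro one_le_power) auto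
      then have d: "0 \<le> d" "d \<le> 1"
        using \<eta> by (auto simp: d_def divide_le_eq)
      have w0: "w M \<ge> 0" by (simp add: w_def)
      have "?E M \<le> sqrt (real (card {0..4 * M})) * e"
      proof (rule L2_set_le_sqrt_card)
        show "e \<ge> 0" using m d F0 by (simp add: e_def)
        show "\<bar>estimated_dynamics (4 * M) (P M k) \<mu> - moment_dynamics f \<mu> k\<bar> \<le> e"
          if "k \<in> {0..4 * M}" for k
          unfolding e_def m_def using that elim(1,3)
          by (intro dynamics_error_le assms cont F) (auto simp: d_def)
      qed
      also have "\<dots> = m * (sqrt (real (4 * M + 1)) * (4 * real M * d)) + m * (F + d) * w M"
        by (simp add: e_def w_def algebra_simps)
      \<comment> \<open>Here the third derivative pays off: \<open>4 * M + 1 \<le> 8 * M\<close>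
        bounds the factor before \<open>d\<close> by \<open>4 * sqrt (2 * M) ^ 3\<close>, which the
        denominator of \<open>d\<close> cancels exactly.\<close>
      also have "sqrt (real (4 * M + 1)) * (4 * real M * d) \<le> 4 * \<eta>"
      proof -
        have "sqrt (real (4 * M + 1)) \<le> sqrt (4 * real (2 * M))"
          using elim(3) by (intro real_sqrt_le_mono) auto
        also have "\<dots> = 2 * sqrt (real (2 * M))" by (simp only: real_sqrt_mult real_sqrt_four)
        finally have "sqrt (real (4 * M + 1)) * (4 * real M * d)
            \<le> 2 * sqrt (real (2 * M)) * (4 * real M * d)"
          using d by (intro mult_right_mono) auto
        also have "\<dots> = 4 * (sqrt (real (2 * M)) * (sqrt (real (2 * M)))\<^sup>2 * d)"
          by simp
        also have "\<dots> = 4 * \<eta>"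
          using elim(3) by (simp add: d_def power2_eq_square power3_eq_cube)
        finally show ?thesis .
      qed
      also have "m * (4 * \<eta>) \<le> r / 2" using small1 by simp
      also have "m * (F + d) * w M \<le> m * (F + 1) * w M"
        using m d w0 by (intro mult_right_mono mult_left_mono) auto
      also have "m * (F + 1) * w M < r / 2" by (fact elim(2))
      finally show "?E M < r" using m by (simp add: mult_left_mono)
    qed
  qed
  then show ?thesis
    by (intro order_tendstoI) (auto intro: always_eventually less_le_trans[OF _ L2_set_nonneg])
qed

end
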